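(* Let $\lambda\in\mathbb R$ and let $\vec v=(v_1,v_2,v_3)$ be a unit vector of $\mathbb R^3$. Let $f:I\to\mathbb R$ and $g:J\to\mathbb R$ be smooth functions on open intervals. The only surfaces of the form $z=f(x)+g(y)$, $(x,y)\in I\times J$, that are $\lambda$-translating solitons with density vector $\vec v$ are the following: \begin{enumerate} \item planes, with $f$ and $g$ linear (affine) functions; \item up to a change of the roles of $f$ and $g$, $f(x)=ax+b$ with $a,b\in\mathbb R$, and $g$ satisfies $$(1+a^2)g''=2\lambda\,(1+a^2+g'^2)^{3/2}+(1+a^2+g'^2)(-v_1a-v_2g'+v_3).$$ In particular, the surface is cylindrical and the rulings are parallel to the vector $(1,0,a)$. \end{enumerate}
   Context: A $\lambda$-translating soliton with density vector $\vec v$ ($|\vec v|=1$) is an orientable surface in $\mathbb R^3$ whose mean curvature $H$ satisfies $2H=2\lambda+\langle N,\vec v\rangle$ at every point, where $N$ is the Gauss map. Here $2H$ is the sum of the principal curvatures, with the sign for which $\Delta X=2HN$ for the position vector $X$. The graph $z=f(x)+g(y)$ is oriented by $N=(-f',-g',1)/\sqrt{1+f'^2+g'^2}$, so the soliton equation reads $$\frac{(1+g'^2)f''+(1+f'^2)g''}{(1+f'^2+g'^2)^{3/2}}=2\lambda+\frac{-v_1f'-v_2g'+v_3}{(1+f'^2+g'^2)^{1/2}}.$$ A cylindrical surface is a surface invariant under the one-parameter group of translations in the direction of a fixed vector (its rulings are the lines in that direction; for a graph over a bounded domain, this means it is foliated by line segments in that direction). Exchanging the roles of $f$ and $g$ also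 exchanges the roles of $x,y$ and of $v_1,v_2$. *)

theory Defs
  imports "HOL-Analysis.Analysis"
begin

definition smooth_fun_on :: "(real \<Rightarrow> real) \<Rightarrow> real set \<Rightarrow> bool" where
  "smooth_fun_on f I \<longleftrightarrow> (\<forall>n. (deriv ^^ n) f differentiable_on I)"
  \<comment> \<open>only used for open I, where it says that f is of class C-infinity on I\<close>

definition pd1 :: "(real \<Rightarrow> real \<Rightarrow> real^3) \<Rightarrow> real \<Rightarrow> real \<Rightarrow> real^3" where
  "pd1 X s t = vector_derivative (\<lambda>u. X u t) (at s)"

definition pd2 :: "(real \<Rightarrow> real \<Rightarrow> real^3) \<Rightarrow> real \<Rightarrow> real \<Rightarrow> real^3" where
  "pd2 X s t = vector_derivative (\<lambda>u. X s u) (at t)"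

inductive_set iterated_partials ::
    "(real \<Rightarrow> real \<Rightarrow> real^3) \<Rightarrow> (real \<Rightarrow> real \<Rightarrow> real^3) set"
  for X where
  base: "X \<in> iterated_partials X"
| step1: "Y \<in> iterated_partials X \<Longrightarrow> pd1 Y \<in> iterated_partials X"
| step2: "Y \<in> iterated_partials X \<Longrightarrow> pd2 Y \<in> iterated_partials X"

text \<open>A parametrized surface is a smooth immersion of an open set; it is oriented by
  the normalized cross product of its coordinate vector fields.\<close>

definition parametrized_surface ::
    "(real \<Rightarrow> real \<Rightarrow> real^3) \<Rightarrow> (real \<times> real) set \<Rightarrow> bool" where
  "parametrized_surface X D \<longleftrightarrow>
     open D \<and>
     (\<forall>Y\<in>iterated_partials X. (\<lambda>(s, t). Y s t) differentiable_on D) \<and>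
     (\<forall>(s, t)\<in>D. cross3 (pd1 X s t) (pd2 X s t) \<noteq> 0)"

definition gauss_map :: "(real \<Rightarrow> real \<Rightarrow> real^3) \<Rightarrow> real \<Rightarrow> real \<Rightarrow> real^3" where
  "gauss_map X s t = sgn (cross3 (pd1 X s t) (pd2 X s t))"

definition first_form :: "(real \<Rightarrow> real \<Rightarrow> real^3) \<Rightarrow> real \<Rightarrow> real \<Rightarrow> real^2^2" where
  "first_form X s t = vector
     [vector [pd1 X s t \<bullet> pd1 X s t, pd1 X s t \<bullet> pd2 X s t],
      vector [pd2 X s t \<bullet> pd1 X s t, pd2 X s t \<bullet> pd2 X s t]]"

definition second_form :: "(real \<Rightarrow> real \<Rightarrow> real^3) \<Rightarrow> real \<Rightarrow> real \<Rightarrow> real^2^2" where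
  "second_form X s t = vector
     [vector [pd1 (pd1 X) s t \<bullet> gauss_map X s t, pd2 (pd1 X) s t \<bullet> gauss_map X s t],
      vector [pd1 (pd2 X) s t \<bullet> gauss_map X s t, pd2 (pd2 X) s t \<bullet> gauss_map X s t]]"

text \<open>Matrix of the Weingarten map in the coordinate basis.\<close>

definition shape_operator :: "(real \<Rightarrow> real \<Rightarrow> real^3) \<Rightarrow> real \<Rightarrow> real \<Rightarrow> real^2^2" where
  "shape_operator X s t = matrix_inv (first_form X s t) ** second_form X s t"

text \<open>The principal curvatures are the eigenvalues of the Weingarten map, counted with
  multiplicity.\<close>

definition principal_curvatures ::
    "(real \<Rightarrow> real \<Rightarrow> real^3) \<Rightarrow> real \<Rightarrow> real \<Rightarrow> real \<Rightarrow> real \<Rightarrow> bool" where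
  "principal_curvatures X s t k1 k2 \<longleftrightarrow>
     (\<forall>k. det (k *\<^sub>R mat 1 - shape_operator X s t) = (k - k1) * (k - k2))"

definition mean_curvature :: "(real \<Rightarrow> real \<Rightarrow> real^3) \<Rightarrow> real \<Rightarrow> real \<Rightarrow> real" where
  "mean_curvature X s t = trace (shape_operator X s t) / 2"

lemma mean_curvature_principal_curvatures:
  assumes "principal_curvatures X s t k1 k2"
  shows "2 * mean_curvature X s t = k1 + k2"
proof -
  let ?A = "shape_operator X s t"
  have *: "(k - ?A$1$1) * (k - ?A$2$2) - ?A$1$2 * ?A$2$1 = (k - k1) * (k - k2)" for k
    using assms unfolding principal_curvatures_def det_2 by (simp add: mat_def)
  show ?thesis
    using *[of 0] *[of 1]
    by (simp add: mean_curvature_def trace_def sum_2 algebra_simps)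
qed

definition translating_soliton ::
    "real \<Rightarrow> real^3 \<Rightarrow> (real \<Rightarrow> real \<Rightarrow> real^3) \<Rightarrow> (real \<times> real) set \<Rightarrow> bool" where
  "translating_soliton lam v X D \<longleftrightarrow>
     parametrized_surface X D \<and>
     (\<forall>(s, t)\<in>D. 2 * mean_curvature X s t = 2 * lam + gauss_map X s t \<bullet> v)"

definition sum_graph :: "(real \<Rightarrow> real) \<Rightarrow> (real \<Rightarrow> real) \<Rightarrow> real \<Rightarrow> real \<Rightarrow> real^3" where
  "sum_graph f g x y = vector [x, y, f x + g y]"

definition graph_set ::
    "(real \<Rightarrow> real) \<Rightarrow> (real \<Rightarrow> real) \<Rightarrow> real set \<Rightarrow> real set \<Rightarrow> (real^3) set" where
  "graph_set f g I J = (\<lambda>(x, y). sum_graph f g x y) ` (I \<times> J)"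

definition planar :: "(real^3) set \<Rightarrow> bool" where
  "planar S \<longleftrightarrow> (\<exists>P. affine P \<and> aff_dim P = 2 \<and> S \<subseteq> P)"

definition translation_invariant :: "real^3 \<Rightarrow> (real^3) set \<Rightarrow> bool" where
  "translation_invariant w S \<longleftrightarrow> (\<forall>t::real. (\<lambda>p. p + t *\<^sub>R w) ` S = S)"

text \<open>A ruling is a nonempty open connected piece (segment, ray or whole line) of a line in
  direction w.  A surface over a proper subdomain of the plane need not contain entire lines,
  so cylindrical means foliated by such pieces; invariance under all translations
  along w is the case in which every piece is a whole line.\<close>

definition ruling :: "real^3 \<Rightarrow> (real^3) set \<Rightarrow> bool" where
  "ruling w L \<longleftrightarrow>
     (\<exists>p T. open T \<and> is_interval T \<and> T \<noteq> {} \<and> L = (\<lambda>t::real. p + t *\<^sub>R w) ` T)"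

definition cylindrical :: "real^3 \<Rightarrow> (real^3) set \<Rightarrow> bool" where
  "cylindrical w S \<longleftrightarrow>
     w \<noteq> 0 \<and> (\<exists>\<L>. pairwise disjnt \<L> \<and> \<Union>\<L> = S \<and> (\<forall>L\<in>\<L>. ruling w L))"

definition profile_ode ::
    "real \<Rightarrow> real \<Rightarrow> real \<Rightarrow> real \<Rightarrow> real \<Rightarrow> (real \<Rightarrow> real) \<Rightarrow> real set \<Rightarrow> bool" where
  "profile_ode lam v1 v2 v3 a g J \<longleftrightarrow>
     (\<forall>y\<in>J. (1 + a\<^sup>2) * deriv (deriv g) y =
        2 * lam * (1 + a\<^sup>2 + (deriv g y)\<^sup>2) powr (3/2)
        + (1 + a\<^sup>2 + (deriv g y)\<^sup>2) * (- v1 * a - v2 * deriv g y + v3))"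

end

theory Submission
  imports Defs "HOL-Computational_Algebra.Polynomial"
begin

text \<open>Write $p = f'(x)$, $q = g'(y)$ and $W = (1+p^2+q^2)^{1/2}$. The fundamental forms of the graph turn
  the soliton condition into
  \[ (1+q^2) f'' + (1+p^2) g'' = 2\<lambda> W^3 + W^2 (v_3 - v_1 p - v_2 q) \]
  (lemma \<open>translating_soliton_sum_graph_iff\<close>). If one summand is affine, this is exactly the profile
  equation for the other one, so both directions of the classification reduce to showing that
  $f''$ or $g''$ vanishes identically (lemma \<open>second_derivative_vanishes\<close>). A plane is the case
  in which both summands are affine, and it is covered by either form of the profile equation.

  Suppose that $f''$ and $g''$ are both nonzero somewhere. Division by $(1+p^2)(1+q^2)$ makes the
  left-hand side a function of $x$ plus a function of $y$. Hence the mixed derivative in $p$ and $q$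
  of the divided right-hand side vanishes wherever $f''g'' \<noteq> 0$
  (lemma \<open>separated_imp_mixed_derivative_zero\<close>). With $a = 1+p^2$ and $b = 1+q^2$ this derivative is
  \[ \frac{2pq}{a^2b^2} \Bigl( v_1 p(p^2+3) + v_2 q(q^2+3) - 2v_3 - \frac{\<lambda> E}{W} \Bigr),
     \quad E = 2a^2 + ab + 2b^2 + 2a + 2b - 4. \]
  Near such points the slopes take infinitely many nonzero values, so the bracket is zero on a product
  of infinite sets. Moving $\<lambda>E/W$ to the other side and squaring gives a polynomial identity
  \[ \<lambda>^2 E^2 = W^2 \bigl( v_1 p(p^2+3) + v_2 q(q^2+3) - 2v_3 \bigr)^2, \]
  which therefore holds for all real $p$ and $q$ (lemma \<open>squared_identity_extend\<close>). Its values at a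
  few small integers already force $v = 0$ (lemma \<open>squared_identity_imp_zero\<close>), which contradicts
  $|v| = 1$.

  An affine $f(x) = ax+b$ makes the graph a union of translates of one open interval of a line in
  direction $(1,0,a)$, one for each $y$, and these are the rulings.\<close>


section \<open>Partial derivatives of separated parametrizations\<close>

text \<open>The sum graph is a function of $s$ plus a function of $t$, and a partial derivative of such
  a map has the same shape, with one of the two summands zero. This gives an invariant for the
  induction over all iterated partial derivatives. The values are constrained on $I \<times> J$ only,
  because smoothness is known only there.\<close>

definition smooth_separated :: "(real \<Rightarrow> real \<Rightarrow> real^3) \<Rightarrow> real set \<Rightarrow> real set \<Rightarrow> bool" where
  "smooth_separated Y I J \<longleftrightarrow>
    (\<exists>F G. (\<forall>i. smooth_fun_on (F i) I) \<and> (\<forall>i. smooth_fun_on (G i) J) \<and>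
       (\<forall>s\<in>I. \<forall>t\<in>J. Y s t = (\<chi> i. F i s + G i t)))"

lemma smooth_fun_on_deriv: "smooth_fun_on f I \<Longrightarrow> smooth_fun_on (deriv f) I"
  unfolding smooth_fun_on_def by (metis funpow_Suc_right o_apply)

lemma smooth_fun_on_has_derivative:
  assumes "smooth_fun_on f I" "open I" "x \<in> I"
  shows "(f has_real_derivative deriv f x) (at x)"
proof -
  have "f differentiable_on I" using assms(1)[unfolded smooth_fun_on_def, rule_format, of 0] by simp
  then have "f differentiable (at x)" using assms(2,3) by (simp add: differentiable_on_eq_differentiable_at)
  then show ?thesis by (simp add: DERIV_deriv_iff_real_differentiable)
qed

lemma smooth_fun_on_const: "smooth_fun_on (\<lambda>_. c) I"
proof -
  have "(deriv ^^ n) (\<lambda>_::real. c) = (\<lambda>_. if n = 0 then c else 0)" for n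
    by (induction n) auto
  then show ?thesis by (simp add: smooth_fun_on_def)
qed

lemma smooth_fun_on_ident: "smooth_fun_on (\<lambda>x. x) I"
proof -
  have "(deriv ^^ n) (\<lambda>x. x) differentiable_on I" for n
  proof (cases n)
    case (Suc m)
    have "(deriv ^^ n) (\<lambda>x::real. x) = (deriv ^^ m) (\<lambda>x. 1)"
      unfolding Suc funpow_Suc_right by simp
    then show ?thesis using smooth_fun_on_const[of 1 I] by (simp add: smooth_fun_on_def)
  qed simp
  then show ?thesis by (simp add: smooth_fun_on_def)
qed

lemma has_vector_derivative_chi:
  assumes "\<And>i. ((\<lambda>x. h i x) has_real_derivative h' i) (at x)"
  shows "((\<lambda>x. (\<chi> i. h i x) :: real^'n) has_vector_derivative (\<chi> i. h' i)) (at x)"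
  unfolding has_vector_derivative_def
  by (subst has_derivative_componentwise_within)
    (use assms in \<open>auto simp: Basis_vec_def inner_axis has_field_derivative_def
       mult.commute[of _ "h' _"] mult_commute_abs\<close>)

lemma pd1_separated:
  assumes "open I" "s \<in> I" "t \<in> J"
    and F: "\<And>i. smooth_fun_on (F i) I"
    and Y: "\<And>s t. s \<in> I \<Longrightarrow> t \<in> J \<Longrightarrow> Y s t = (\<chi> i. F i s + G i t :: real^3)"
  shows "pd1 Y s t = (\<chi> i. deriv (F i) s)"
  unfolding pd1_def
proof (rule vector_derivative_at)
  have "((\<lambda>u. (\<chi> i. F i u + G i t)) has_vector_derivative (\<chi> i. deriv (F i) s)) (at s)"
    by (rule has_vector_derivative_chi)
      (use smooth_fun_on_has_derivative[OF F assms(1,2)] in \<open>auto intro!: derivative_eq_intros\<close>)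
  then show "((\<lambda>u. Y u t) has_vector_derivative (\<chi> i. deriv (F i) s)) (at s)"
    by (rule has_vector_derivative_transform_within_open[OF _ assms(1,2)]) (simp add: Y assms(3))
qed

lemma pd2_separated:
  assumes "open J" "s \<in> I" "t \<in> J"
    and G: "\<And>i. smooth_fun_on (G i) J"
    and Y: "\<And>s t. s \<in> I \<Longrightarrow> t \<in> J \<Longrightarrow> Y s t = (\<chi> i. F i s + G i t :: real^3)"
  shows "pd2 Y s t = (\<chi> i. deriv (G i) t)"
  unfolding pd2_def
proof (rule vector_derivative_at)
  have "((\<lambda>u. (\<chi> i. F i s + G i u)) has_vector_derivative (\<chi> i. deriv (G i) t)) (at t)"
    by (rule has_vector_derivative_chi)
      (use smooth_fun_on_has_derivative[OF G assms(1,3)] in \<open>auto intro!: derivative_eq_intros\<close>)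
  then show "((\<lambda>u. Y s u) has_vector_derivative (\<chi> i. deriv (G i) t)) (at t)"
    by (rule has_vector_derivative_transform_within_open[OF _ assms(1,3)]) (simp add: Y assms(2))
qed

lemma smooth_separated_iterated_partials:
  assumes "open I" "open J" "smooth_separated X I J" "Y \<in> iterated_partials X"
  shows "smooth_separated Y I J"
  using assms(4)
proof induction
  case base
  then show ?case by (rule assms(3))
next
  case (step1 Y)
  then obtain F G where FG: "\<And>i. smooth_fun_on (F i) I" "\<And>i. smooth_fun_on (G i) J"
    "\<And>s t. s \<in> I \<Longrightarrow> t \<in> J \<Longrightarrow> Y s t = (\<chi> i. F i s + G i t)"
    unfolding smooth_separated_def by blast
  show ?case unfolding smooth_separated_def
    by (rule exI[of _ "\<lambda>i. deriv (F i)"], rule exI[of _ "\<lambda>i _. 0"])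
      (simp add: pd1_separated[OF assms(1) _ _ FG(1,3)] smooth_fun_on_deriv FG smooth_fun_on_const)
next
  case (step2 Y)
  then obtain F G where FG: "\<And>i. smooth_fun_on (F i) I" "\<And>i. smooth_fun_on (G i) J"
    "\<And>s t. s \<in> I \<Longrightarrow> t \<in> J \<Longrightarrow> Y s t = (\<chi> i. F i s + G i t)"
    unfolding smooth_separated_def by blast
  show ?case unfolding smooth_separated_def
    by (rule exI[of _ "\<lambda>i _. 0"], rule exI[of _ "\<lambda>i. deriv (G i)"])
      (simp add: pd2_separated[OF assms(2) _ _ FG(2,3)] smooth_fun_on_deriv FG smooth_fun_on_const)
qed

lemma smooth_separated_imp_differentiable_on:
  assumes "open I" "open J" "smooth_separated Y I J"
  shows "(\<lambda>(s, t). Y s t) differentiable_on (I \<times> J)"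
proof -
  obtain F G where FG: "\<And>i. smooth_fun_on (F i) I" "\<And>i. smooth_fun_on (G i) J"
    "\<And>s t. s \<in> I \<Longrightarrow> t \<in> J \<Longrightarrow> Y s t = (\<chi> i. F i s + G i t)"
    using assms(3) unfolding smooth_separated_def by blast
  have diff: "(\<lambda>z. \<chi> i. F i (fst z) + G i (snd z)) differentiable (at z within I \<times> J)"
    if z: "z \<in> I \<times> J" for z
  proof (subst differentiable_componentwise_within, rule ballI)
    fix b :: "real^3" assume "b \<in> Basis"
    then obtain i where b: "b = axis i 1" by (auto simp: Basis_vec_def)
    have "F i differentiable (at (fst z))" "G i differentiable (at (snd z))"
      using z FG assms(1,2) by (auto intro!: smooth_fun_on_has_derivative simp flip: DERIV_deriv_iff_real_differentiable)
    moreover have "fst differentiable (at z within I \<times> J)" "snd differentiable (at z within I \<times> J)"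
      by (simp_all add: bounded_linear_imp_differentiable bounded_linear_fst bounded_linear_snd)
    ultimately have "(\<lambda>z. F i (fst z)) differentiable (at z within I \<times> J)"
      "(\<lambda>z. G i (snd z)) differentiable (at z within I \<times> J)"
      by (auto intro: differentiable_compose)
    then show "(\<lambda>z. (\<chi> i. F i (fst z) + G i (snd z)) \<bullet> b) differentiable (at z within I \<times> J)"
      by (simp add: b inner_axis)
  qed
  show ?thesis
    unfolding differentiable_on_def
  proof
    fix z assume z: "z \<in> I \<times> J"
    show "(\<lambda>(s, t). Y s t) differentiable (at z within I \<times> J)"
      by (rule differentiable_transform_within[OF diff[OF z] zero_less_one z]) (auto simp: FG(3))
  qed
qed

lemma sum_graph_smooth_separated:
  assumes "smooth_fun_on f I" "smooth_fun_on g J"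
  shows "smooth_separated (sum_graph f g) I J"
  unfolding smooth_separated_def
  by (rule exI[of _ "\<lambda>i. if i = 1 then (\<lambda>x. x) else if i = 2 then (\<lambda>_. 0) else f"],
      rule exI[of _ "\<lambda>i. if i = 1 then (\<lambda>_. 0) else if i = 2 then (\<lambda>x. x) else g"])
    (use assms in \<open>auto simp: smooth_fun_on_ident smooth_fun_on_const sum_graph_def vec_eq_iff forall_3\<close>)

lemma pd_sum_graph:
  assumes IJ: "open I" "open J" and fg: "smooth_fun_on f I" "smooth_fun_on g J"
    and st: "s \<in> I" "t \<in> J"
  shows "pd1 (sum_graph f g) s t = vector [1, 0, deriv f s]"
    and "pd2 (sum_graph f g) s t = vector [0, 1, deriv g t]"
    and "pd1 (pd1 (sum_graph f g)) s t = vector [0, 0, deriv (deriv f) s]"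
    and "pd2 (pd1 (sum_graph f g)) s t = vector [0, 0, 0]"
    and "pd1 (pd2 (sum_graph f g)) s t = vector [0, 0, 0]"
    and "pd2 (pd2 (sum_graph f g)) s t = vector [0, 0, deriv (deriv g) t]"
proof -
  let ?F = "\<lambda>h i. if i = 1 then (\<lambda>x. x) else if i = 2 then (\<lambda>_. 0) else h :: real \<Rightarrow> real"
  let ?G = "\<lambda>h i. if i = 1 then (\<lambda>_. 0) else if i = 2 then (\<lambda>x. x) else h :: real \<Rightarrow> real"
  let ?c = "\<lambda>a b h i. if i = 1 then (\<lambda>_. a) else if i = 2 then (\<lambda>_. b) else h :: real \<Rightarrow> real"
  note sm = smooth_fun_on_ident smooth_fun_on_const smooth_fun_on_deriv
  have 1: "pd1 (sum_graph f g) s t = (\<chi> i. deriv (?F f i) s)" if "s \<in> I" "t \<in> J" for s t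
    by (rule pd1_separated[where F = "?F f" and G = "?G g", OF IJ(1) that])
      (use fg in \<open>auto simp: sm sum_graph_def vec_eq_iff forall_3\<close>)
  have 2: "pd2 (sum_graph f g) s t = (\<chi> i. deriv (?G g i) t)" if "s \<in> I" "t \<in> J" for s t
    by (rule pd2_separated[where F = "?F f" and G = "?G g", OF IJ(2) that])
      (use fg in \<open>auto simp: sm sum_graph_def vec_eq_iff forall_3\<close>)
  show "pd1 (sum_graph f g) s t = vector [1, 0, deriv f s]"
    "pd2 (sum_graph f g) s t = vector [0, 1, deriv g t]"
    using 1[OF st] 2[OF st] by (auto simp: vec_eq_iff forall_3)
  have "pd1 (pd1 (sum_graph f g)) s t = (\<chi> i. deriv (?c 1 0 (deriv f) i) s)"
    by (rule pd1_separated[where G = "\<lambda>_ _. 0", OF IJ(1) st])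
      (use fg in \<open>auto simp: 1 sm vec_eq_iff forall_3\<close>)
  then show "pd1 (pd1 (sum_graph f g)) s t = vector [0, 0, deriv (deriv f) s]"
    by (auto simp: vec_eq_iff forall_3)
  have "pd2 (pd2 (sum_graph f g)) s t = (\<chi> i. deriv (?c 0 1 (deriv g) i) t)"
    by (rule pd2_separated[where F = "\<lambda>_ _. 0", OF IJ(2) st])
      (use fg in \<open>auto simp: 2 sm vec_eq_iff forall_3\<close>)
  then show "pd2 (pd2 (sum_graph f g)) s t = vector [0, 0, deriv (deriv g) t]"
    by (auto simp: vec_eq_iff forall_3)
  have "pd2 (pd1 (sum_graph f g)) s t = (\<chi> i. deriv (\<lambda>_. 0) t)"
    by (rule pd2_separated[where F = "?c 1 0 (deriv f)", OF IJ(2) st])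
      (use fg in \<open>auto simp: 1 sm vec_eq_iff forall_3\<close>)
  then show "pd2 (pd1 (sum_graph f g)) s t = vector [0, 0, 0]"
    by (auto simp: vec_eq_iff forall_3)
  have "pd1 (pd2 (sum_graph f g)) s t = (\<chi> i. deriv (\<lambda>_. 0) s)"
    by (rule pd1_separated[where G = "?c 0 1 (deriv g)", OF IJ(1) st])
      (use fg in \<open>auto simp: 2 sm vec_eq_iff forall_3\<close>)
  then show "pd1 (pd2 (sum_graph f g)) s t = vector [0, 0, 0]"
    by (auto simp: vec_eq_iff forall_3)
qed

lemma matrix_inv_eqI:
  fixes A B :: "'a::semiring_1^'n^'n"
  assumes "A ** B = mat 1" "B ** A = mat 1"
  shows "matrix_inv A = B"
proof -
  have "A ** matrix_inv A = mat 1"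
    unfolding matrix_inv_def by (rule someI2[of _ B]) (use assms in auto)
  then have "B ** (A ** matrix_inv A) = B" by simp
  then show ?thesis by (simp add: matrix_mul_assoc assms(2))
qed

text \<open>Twice the mean curvature is the trace of the inverse of the first fundamental form times the
  second; for $2 \<times> 2$ matrices the adjugate makes this explicit.\<close>

lemma trace_matrix_inv_mult_2:
  fixes a b c d :: real
  assumes "a * d - b * c \<noteq> 0"
  shows "trace (matrix_inv (vector [vector [a, b], vector [c, d]] :: real^2^2) **
    vector [vector [p, q], vector [r, s]] :: real^2^2) = (d * p - b * r - c * q + a * s) / (a * d - b * c)"
proof -
  define D where "D = a * d - b * c"
  have D: "D \<noteq> 0" "a * d = D + b * c" using assms by (simp_all add: D_def)
  let ?A = "vector [vector [a, b], vector [c, d]] :: real^2^2"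
  let ?B = "vector [vector [d / D, - b / D], vector [- c / D, a / D]] :: real^2^2"
  have "?A ** ?B = mat 1"
    using D by (simp add: matrix_matrix_mult_def mat_def vec_eq_iff forall_2 sum_2 field_simps)
  moreover have "?B ** ?A = mat 1"
    using D by (simp add: matrix_matrix_mult_def mat_def vec_eq_iff forall_2 sum_2 field_simps)
  ultimately have "matrix_inv ?A = ?B" by (rule matrix_inv_eqI)
  then show ?thesis
    using D(1) unfolding D_def[symmetric]
    by (simp add: matrix_matrix_mult_def trace_def sum_2 add_divide_distrib diff_divide_distrib)
qed

text \<open>The surface is regular because the last component of the normal $(-f',-g',1)$ is $1$. The
  soliton equation is cleared of denominators by multiplication with the cube of the positive number
  $W = (1+f'^2+g'^2)^{1/2}$, whose square is the determinant of the first fundamental form.\<close>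

lemma translating_soliton_sum_graph_iff:
  assumes IJ: "open I" "open J" and fg: "smooth_fun_on f I" "smooth_fun_on g J"
  shows "translating_soliton lam v (sum_graph f g) (I \<times> J) \<longleftrightarrow>
    (\<forall>x\<in>I. \<forall>y\<in>J. let p = deriv f x; q = deriv g y in
       (1 + q\<^sup>2) * deriv (deriv f) x + (1 + p\<^sup>2) * deriv (deriv g) y
       = 2 * lam * sqrt (1 + p\<^sup>2 + q\<^sup>2) ^ 3 + (1 + p\<^sup>2 + q\<^sup>2) * (v$3 - v$1 * p - v$2 * q))"
proof -
  let ?X = "sum_graph f g"
  have cross: "cross3 (pd1 ?X x y) (pd2 ?X x y) = vector [- deriv f x, - deriv g y, 1]"
    if "x \<in> I" "y \<in> J" for x y
    by (simp add: pd_sum_graph[OF assms that] cross3_def)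
  have surf: "parametrized_surface ?X (I \<times> J)"
    unfolding parametrized_surface_def
  proof (intro conjI ballI)
    show "open (I \<times> J)" by (intro open_Times IJ)
    show "(\<lambda>(s, t). Y s t) differentiable_on I \<times> J" if "Y \<in> iterated_partials ?X" for Y
      by (rule smooth_separated_imp_differentiable_on[OF IJ smooth_separated_iterated_partials
            [OF IJ sum_graph_smooth_separated[OF fg] that]])
    show "case z of (s, t) \<Rightarrow> cross3 (pd1 ?X s t) (pd2 ?X s t) \<noteq> 0" if "z \<in> I \<times> J" for z
      using that by (auto simp: cross vec_eq_iff forall_3)
  qed
  have eq: "2 * mean_curvature ?X x y = 2 * lam + gauss_map ?X x y \<bullet> v \<longleftrightarrow>
     (1 + q\<^sup>2) * deriv (deriv f) x + (1 + p\<^sup>2) * deriv (deriv g) y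
       = 2 * lam * sqrt (1 + p\<^sup>2 + q\<^sup>2) ^ 3 + (1 + p\<^sup>2 + q\<^sup>2) * (v$3 - v$1 * p - v$2 * q)"
    if xy: "x \<in> I" "y \<in> J" and p: "p = deriv f x" and q: "q = deriv g y" for x y p q
  proof -
    define W where "W = sqrt (1 + p\<^sup>2 + q\<^sup>2)"
    have s: "1 + p\<^sup>2 + q\<^sup>2 > 0" by (simp add: add_pos_nonneg)
    then have W: "W > 0" "W\<^sup>2 = 1 + p\<^sup>2 + q\<^sup>2" unfolding W_def by simp_all
    have N: "gauss_map ?X x y = (1 / W) *\<^sub>R vector [- p, - q, 1]"
      unfolding gauss_map_def cross[OF xy] sgn_div_norm p[symmetric] q[symmetric] W_def
      by (simp add: norm_eq_sqrt_inner inner_vec_def sum_3 power2_eq_square add_ac inverse_eq_divide)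
    have det: "(1 + p\<^sup>2) * (1 + q\<^sup>2) - p * q * (q * p) = W\<^sup>2"
      unfolding W by algebra
    have I: "first_form ?X x y = vector [vector [1 + p\<^sup>2, p * q], vector [q * p, 1 + q\<^sup>2]]"
      unfolding first_form_def pd_sum_graph[OF assms xy] p[symmetric] q[symmetric]
      by (simp add: inner_vec_def sum_3 power2_eq_square)
    have II: "second_form ?X x y = vector [vector [deriv (deriv f) x / W, 0], vector [0, deriv (deriv g) y / W]]"
      unfolding second_form_def N pd_sum_graph[OF assms xy]
      by (simp add: inner_vec_def sum_3)
    have H: "2 * mean_curvature ?X x y = ((1 + q\<^sup>2) * deriv (deriv f) x + (1 + p\<^sup>2) * deriv (deriv g) y) / W ^ 3"
      unfolding mean_curvature_def shape_operator_def I II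
      using W(1) by (subst trace_matrix_inv_mult_2)
        (simp_all add: det divide_simps, simp add: algebra_simps power2_eq_square power3_eq_cube)
    have Nv: "gauss_map ?X x y \<bullet> v = (v$3 - v$1 * p - v$2 * q) / W"
      unfolding N by (simp add: inner_vec_def sum_3 algebra_simps diff_divide_distrib add_divide_distrib)
    have "2 * lam + (v$3 - v$1 * p - v$2 * q) / W =
       (2 * lam * W ^ 3 + W\<^sup>2 * (v$3 - v$1 * p - v$2 * q)) / W ^ 3"
      using W(1) by (simp add: divide_simps) (simp add: algebra_simps power2_eq_square power3_eq_cube)
    then show ?thesis
      unfolding H Nv W(2)[symmetric] W_def[symmetric] using W(1) by simp
  qed
  show ?thesis
    unfolding translating_soliton_def Let_def using surf eq by auto
qed

section \<open>Separation of variables\<close>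

lemma sqrt_has_derivative_p:
  "((\<lambda>p. sqrt (1+p\<^sup>2+q\<^sup>2)) has_real_derivative p / sqrt (1+p\<^sup>2+q\<^sup>2)) (at p)"
proof -
  have s: "1+p\<^sup>2+q\<^sup>2 > 0" by (simp add: add_pos_nonneg)
  have "((\<lambda>p. 1+p\<^sup>2+q\<^sup>2) has_real_derivative 2 * p) (at p)"
    by (auto intro!: derivative_eq_intros)
  from DERIV_chain2[OF DERIV_real_sqrt[OF s] this] show ?thesis
    by (simp add: field_simps)
qed

lemma sqrt_has_derivative_q:
  "((\<lambda>q. sqrt (1+p\<^sup>2+q\<^sup>2)) has_real_derivative q / sqrt (1+p\<^sup>2+q\<^sup>2)) (at q)"
  using sqrt_has_derivative_p[of p q] by (simp add: add_ac)

lemma sqrt_cubed_has_derivative: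
  "((\<lambda>p. sqrt (1+p\<^sup>2+q\<^sup>2)^3) has_real_derivative 3 * p * sqrt (1+p\<^sup>2+q\<^sup>2)) (at p)"
proof -
  have "real 3 * (p / w * w ^ (3 - Suc 0)) = 3 * p * w" if "w > 0" for w :: real
    using that by (simp add: power2_eq_square)
  moreover have "sqrt (1+p\<^sup>2+q\<^sup>2) > 0" by (simp add: add_pos_nonneg)
  ultimately show ?thesis
    by (intro DERIV_cong[OF DERIV_power[OF sqrt_has_derivative_p]]) blast
qed

text \<open>If $R(P(x),Q(y))$ is a sum $\<alpha>(x) + \<beta>(y)$, its mixed derivative
  $R_{pq}(P(x),Q(y)) P'(x) Q'(y)$ vanishes. Taking a
  difference in $y$ first eliminates $\<alpha>$, so that only $R$, $P$ and $Q$ are differentiated.\<close>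

lemma separated_imp_mixed_derivative_zero:
  fixes R Rp Rpq :: "real \<Rightarrow> real \<Rightarrow> real" and P Q :: "real \<Rightarrow> real"
  assumes "open I" "open J"
    and R: "\<And>p q. ((\<lambda>p. R p q) has_real_derivative Rp p q) (at p)"
    and Rp: "\<And>p q. (Rp p has_real_derivative Rpq p q) (at q)"
    and P: "\<And>x. x \<in> I \<Longrightarrow> (P has_real_derivative P' x) (at x)"
    and Q: "\<And>y. y \<in> J \<Longrightarrow> (Q has_real_derivative Q' y) (at y)"
    and sep: "\<And>x y. x \<in> I \<Longrightarrow> y \<in> J \<Longrightarrow> R (P x) (Q y) = \<alpha> x + \<beta> y"
    and xy: "x \<in> I" "y \<in> J" "P' x \<noteq> 0" "Q' y \<noteq> 0"
  shows "Rpq (P x) (Q y) = 0"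
proof -
  have const: "Rp (P x) (Q y') = Rp (P x) (Q y)" if y': "y' \<in> J" for y'
  proof -
    have "((\<lambda>x. R (P x) (Q y') - R (P x) (Q y)) has_real_derivative
           Rp (P x) (Q y') * P' x - Rp (P x) (Q y) * P' x) (at x)"
      by (intro DERIV_diff DERIV_chain2[OF R P] xy)
    moreover have "((\<lambda>x. R (P x) (Q y') - R (P x) (Q y)) has_real_derivative 0) (at x)"
      by (rule has_field_derivative_transform_within_open
            [OF DERIV_const[where k = "\<beta> y' - \<beta> y"] \<open>open I\<close> xy(1)]) (simp add: sep y' xy)
    ultimately have "Rp (P x) (Q y') * P' x - Rp (P x) (Q y) * P' x = 0"
      by (rule DERIV_unique)
    then show ?thesis using xy(3) by simp
  qed
  have "((\<lambda>y. Rp (P x) (Q y)) has_real_derivative Rpq (P x) (Q y) * Q' y) (at y)"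
    by (rule DERIV_chain2[OF Rp Q[OF xy(2)]])
  moreover have "((\<lambda>y. Rp (P x) (Q y)) has_real_derivative 0) (at y)"
    by (rule has_field_derivative_transform_within_open[OF DERIV_const \<open>open J\<close> xy(2)])
      (simp add: const)
  ultimately have "Rpq (P x) (Q y) * Q' y = 0"
    by (rule DERIV_unique)
  then show ?thesis using xy(4) by simp
qed

text \<open>The right-hand side of the soliton equation divided by $(1+p^2)(1+q^2)$, in terms of the
  slopes $p = f'$ and $q = g'$. The equation says that its value at these slopes is
  $f''/(1+f'^2) + g''/(1+g'^2)$, a function of $x$ plus a function of $y$.\<close>

definition soliton_quotient :: "real \<Rightarrow> real \<Rightarrow> real \<Rightarrow> real \<Rightarrow> real \<Rightarrow> real \<Rightarrow> real" where
  "soliton_quotient lam v1 v2 v3 p q =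
    (2 * lam * sqrt (1+p\<^sup>2+q\<^sup>2)^3 + (1+p\<^sup>2+q\<^sup>2) * (v3-v1 * p-v2 * q)) / ((1+p\<^sup>2) * (1+q\<^sup>2))"

definition soliton_quotient_dp :: "real \<Rightarrow> real \<Rightarrow> real \<Rightarrow> real \<Rightarrow> real \<Rightarrow> real \<Rightarrow> real" where
  "soliton_quotient_dp lam v1 v2 v3 p q =
    (2 * lam * p * sqrt (1+p\<^sup>2+q\<^sup>2) * (p\<^sup>2 - 2 * q\<^sup>2+1) - 2 * p * q\<^sup>2 * (v3-v1 * p-v2 * q)
     - v1 * (1+p\<^sup>2) * (1+p\<^sup>2+q\<^sup>2)) / ((1+p\<^sup>2)^2 * (1+q\<^sup>2))"

text \<open>With $a = 1+p^2$, $b = 1+q^2$ and $W^2 = a+b-1$, this is the polynomial $E$ for which the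
  mixed derivative of $W^3/(ab)$ in $p$ and $q$ is $-pqE/(a^2b^2W)$.\<close>

definition mixed_poly :: "real \<Rightarrow> real \<Rightarrow> real" where
  "mixed_poly p q =
    2 * (1+p\<^sup>2)^2 + (1+p\<^sup>2) * (1+q\<^sup>2) + 2 * (1+q\<^sup>2)^2 + 2 * (1+p\<^sup>2) + 2 * (1+q\<^sup>2) - 4"

definition soliton_quotient_dpdq :: "real \<Rightarrow> real \<Rightarrow> real \<Rightarrow> real \<Rightarrow> real \<Rightarrow> real \<Rightarrow> real" where
  "soliton_quotient_dpdq lam v1 v2 v3 p q = 2 * p * q / ((1+p\<^sup>2)^2 * (1+q\<^sup>2)^2) *
    (v1 * (p * (p\<^sup>2+3)) + v2 * (q * (q\<^sup>2+3)) - 2 * v3 - lam * mixed_poly p q / sqrt (1+p\<^sup>2+q\<^sup>2))"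

text \<open>Both derivatives below follow the quotient rule. The denominators are products in which one factor
  does not involve the variable, so one power of a factor cancels; what remains is a polynomial
  identity once the odd powers of $W = (1+p^2+q^2)^{1/2}$ are reduced to a single one.\<close>

lemma soliton_quotient_has_derivative:
  "((\<lambda>p. soliton_quotient lam v1 v2 v3 p q) has_real_derivative
     soliton_quotient_dp lam v1 v2 v3 p q) (at p)"
proof -
  define W where "W p = sqrt (1+p\<^sup>2+q\<^sup>2)" for p
  define N where "N p = 2 * lam * W p^3 + (1+p\<^sup>2+q\<^sup>2) * (v3-v1 * p-v2 * q)" for p
  define N' where "N' = 6 * lam * p * W p + (2 * p * (v3-v1 * p-v2 * q) - v1 * (1+p\<^sup>2+q\<^sup>2))"
  have W: "(W p)^3 = W p * (1+p\<^sup>2+q\<^sup>2)"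
    unfolding W_def by (simp add: power3_eq_cube add_nonneg_nonneg)
  have N: "(N has_real_derivative N') (at p)"
    unfolding N_def N'_def W_def
    by (rule derivative_eq_intros refl sqrt_cubed_has_derivative | simp)+
  have D: "((\<lambda>p. (1+p\<^sup>2) * (1+q\<^sup>2)) has_real_derivative 2 * p * (1+q\<^sup>2)) (at p)"
    by (rule derivative_eq_intros refl | simp)+
  have nz: "1+p\<^sup>2 \<noteq> 0" "1+q\<^sup>2 \<noteq> 0" by (smt (verit) zero_le_power2)+
  have key: "N' * (1+p\<^sup>2) - N p * (2 * p) = 2 * lam * p * W p * (p\<^sup>2 - 2 * q\<^sup>2+1)
   - 2 * p * q\<^sup>2 * (v3-v1 * p-v2 * q) - v1 * (1+p\<^sup>2) * (1+p\<^sup>2+q\<^sup>2)"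
    unfolding N_def N'_def W by algebra
  have "(N' * ((1+p\<^sup>2) * (1+q\<^sup>2)) - N p * (2 * p * (1+q\<^sup>2)))
      / ((1+p\<^sup>2) * (1+q\<^sup>2) * ((1+p\<^sup>2) * (1+q\<^sup>2)))
    = ((N' * (1+p\<^sup>2) - N p * (2 * p)) * (1+q\<^sup>2)) / (((1+p\<^sup>2)\<^sup>2 * (1+q\<^sup>2)) * (1+q\<^sup>2))"
    by (rule arg_cong2[where f = divide]) (simp_all add: algebra_simps power2_eq_square)
  also have "\<dots> = soliton_quotient_dp lam v1 v2 v3 p q"
    unfolding soliton_quotient_dp_def key W_def using nz by simp
  finally show ?thesis
    using DERIV_divide[OF N D] nz by (simp add: soliton_quotient_def N_def W_def)
qed

lemma soliton_quotient_dp_has_derivative: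
  "((\<lambda>q. soliton_quotient_dp lam v1 v2 v3 p q) has_real_derivative
     soliton_quotient_dpdq lam v1 v2 v3 p q) (at q)"
proof -
  define W where "W q = sqrt (1+p\<^sup>2+q\<^sup>2)" for q
  define N where "N q = 2 * lam * p * W q * (p\<^sup>2 - 2 * q\<^sup>2+1)
   - 2 * p * q\<^sup>2 * (v3-v1 * p-v2 * q) - v1 * (1+p\<^sup>2) * (1+p\<^sup>2+q\<^sup>2)" for q
  define r where "r = 1 / W q"
  define N' where "N' = 2 * lam * p * (q * r * (p\<^sup>2 - 2 * q\<^sup>2+1) - 4 * q * W q)
   - 2 * p * (2 * q * (v3-v1 * p-v2 * q) - q\<^sup>2 * v2) - v1 * (1+p\<^sup>2) * (2 * q)"
  have s: "1+p\<^sup>2+q\<^sup>2 > 0" by (simp add: add_pos_nonneg)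
  \<comment> \<open>Writing $W$ through its reciprocal makes the numerator polynomial in $p$, $q$ and $r$.\<close>
  have W: "W q = r * (1+p\<^sup>2+q\<^sup>2)"
    unfolding W_def r_def using s by (simp add: real_div_sqrt)
  have W': "(W has_real_derivative q * r) (at q)"
    unfolding W_def r_def using sqrt_has_derivative_q[of p q] by simp
  have N: "(N has_real_derivative N') (at q)"
    unfolding N_def N'_def
    by (auto intro!: derivative_eq_intros W' simp: algebra_simps)
  have D: "((\<lambda>q. (1+p\<^sup>2)\<^sup>2 * (1+q\<^sup>2)) has_real_derivative (1+p\<^sup>2)\<^sup>2 * (2 * q)) (at q)"
    by (rule derivative_eq_intros refl | simp)+
  have nz: "1+p\<^sup>2 \<noteq> 0" "1+q\<^sup>2 \<noteq> 0" by (smt (verit) zero_le_power2)+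
  have key: "N' * (1+q\<^sup>2) - N q * (2 * q) =
      2 * p * q * (v1 * (p * (p\<^sup>2+3)) + v2 * (q * (q\<^sup>2+3)) - 2 * v3 - lam * mixed_poly p q * r)"
    unfolding N_def N'_def W mixed_poly_def by algebra
  have "(N' * ((1+p\<^sup>2)\<^sup>2 * (1+q\<^sup>2)) - N q * ((1+p\<^sup>2)\<^sup>2 * (2 * q)))
      / ((1+p\<^sup>2)\<^sup>2 * (1+q\<^sup>2) * ((1+p\<^sup>2)\<^sup>2 * (1+q\<^sup>2)))
    = ((N' * (1+q\<^sup>2) - N q * (2 * q)) * (1+p\<^sup>2)\<^sup>2) / (((1+p\<^sup>2)\<^sup>2 * (1+q\<^sup>2)\<^sup>2) * (1+p\<^sup>2)\<^sup>2)"
    by (rule arg_cong2[where f = divide]) (simp_all add: algebra_simps power2_eq_square)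
  also have "\<dots> = soliton_quotient_dpdq lam v1 v2 v3 p q"
    unfolding soliton_quotient_dpdq_def key using nz by (simp add: r_def W_def)
  finally show ?thesis
    using DERIV_divide[OF N D] nz by (simp add: soliton_quotient_dp_def N_def W_def)
qed

text \<open>The slopes at which the mixed derivative is known to vanish fill only a product of two infinite
  sets. Squaring removes the root and leaves a polynomial identity, and a polynomial with infinitely
  many zeros vanishes; this is applied in $p$ for each fixed $q$ of the second set and then in $q$
  for arbitrary $p$.\<close>

lemma squared_identity_extend:
  fixes lam v1 v2 v3 :: real and A B :: "real set"
  assumes "infinite A" "infinite B"
    and "\<And>p q. p \<in> A \<Longrightarrow> q \<in> B \<Longrightarrow> lam\<^sup>2 * (mixed_poly p q)\<^sup>2 =
      (1+p\<^sup>2+q\<^sup>2) * (v1 * (p * (p\<^sup>2+3)) + v2 * (q * (q\<^sup>2+3)) - 2 * v3)\<^sup>2"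
  shows "lam\<^sup>2 * (mixed_poly p q)\<^sup>2 =
      (1+p\<^sup>2+q\<^sup>2) * (v1 * (p * (p\<^sup>2+3)) + v2 * (q * (q\<^sup>2+3)) - 2 * v3)\<^sup>2"
proof -
  have ext: "poly h t = 0" if "infinite C" "\<And>t. t \<in> C \<Longrightarrow> poly h t = 0" for h :: "real poly" and C t
  proof -
    have "C \<subseteq> {t. poly h t = 0}" using that(2) by blast
    then have "h = 0" using that(1) poly_roots_finite[of h] finite_subset by blast
    then show ?thesis by simp
  qed
  \<comment> \<open>Constants and the variable are kept opaque, since multiplying out the polynomial is expensive.\<close>
  define X :: "real poly" where "X = [:0,1:]"
  define K :: "real \<Rightarrow> real poly" where "K c = [:c:]" for c
  have X: "poly X t = t" and K: "poly (K c) t = c" for c t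
    by (simp_all add: X_def K_def)
  define h where "h w1 w2 c =
     K (lam\<^sup>2) * (2 * (1+X\<^sup>2)^2 + (1+X\<^sup>2) * (1+(K c)\<^sup>2) + 2 * (1+(K c)\<^sup>2)^2 + 2 * (1+X\<^sup>2) + 2 * (1+(K c)\<^sup>2) - 4)\<^sup>2
      - (1+X\<^sup>2+(K c)\<^sup>2) * (K w1 * (X * (X\<^sup>2+3)) + K w2 * (K c * ((K c)\<^sup>2+3)) - 2 * K v3)\<^sup>2" for w1 w2 c
  have h: "poly (h w1 w2 c) t = lam\<^sup>2 * (mixed_poly t c)\<^sup>2
      - (1+t\<^sup>2+c\<^sup>2) * (w1 * (t * (t\<^sup>2+3)) + w2 * (c * (c\<^sup>2+3)) - 2 * v3)\<^sup>2" for w1 w2 c t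
    by (simp add: h_def mixed_poly_def X K)
  have 1: "poly (h v1 v2 q) p = 0" if "q \<in> B" for p q
    by (rule ext[OF assms(1)]) (use assms(3) that in \<open>simp add: h\<close>)
  \<comment> \<open>Exchanging the variables together with $v_1$ and $v_2$ preserves the identity, so the same
    polynomial serves for both variables.\<close>
  have sym: "poly (h v2 v1 p) q = poly (h v1 v2 q) p" for p q
  proof -
    have "mixed_poly q p = mixed_poly p q" by (simp add: mixed_poly_def algebra_simps)
    moreover have "1+q\<^sup>2+p\<^sup>2 = 1+p\<^sup>2+q\<^sup>2" by simp
    ultimately show ?thesis by (simp only: h add.commute[of "v2 * _"])
  qed
  have "poly (h v2 v1 p) q = 0"
    by (rule ext[OF assms(2)]) (use 1 sym in simp)
  then have "poly (h v1 v2 q) p = 0" by (simp only: sym)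
  then show ?thesis by (simp add: h)
qed

text \<open>The left-hand side is even in $p$, so the values at $(1,0)$ and $(-1,0)$ force $v_1v_3 = 0$.
  If $v_3 \<noteq> 0$, then $v_1 = 0$ and the values at $(0,0)$ and $(1,0)$ give incompatible ratios of
  $\<lambda>^2$ and $v_3^2$. Hence $v_3 = 0$, and the value at the origin gives $\<lambda> = 0$.\<close>

lemma squared_identity_imp_zero:
  fixes lam v1 v2 v3 :: real
  assumes "\<And>p q. lam\<^sup>2 * (mixed_poly p q)\<^sup>2 =
      (1+p\<^sup>2+q\<^sup>2) * (v1 * (p * (p\<^sup>2+3)) + v2 * (q * (q\<^sup>2+3)) - 2 * v3)\<^sup>2"
  shows "v1 = 0 \<and> v2 = 0 \<and> v3 = 0"
proof -
  note ev = assms[unfolded mixed_poly_def]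
  have 00: "25 * lam\<^sup>2 = 4 * v3\<^sup>2" using ev[of 0 0] by (simp add: algebra_simps power2_eq_square)
  have p0: "196 * lam\<^sup>2 = 2 * (4 * v1-2 * v3)\<^sup>2" "196 * lam\<^sup>2 = 2 * (4 * v1+2 * v3)\<^sup>2"
    using ev[of 1 0] ev[of "-1" 0] by (simp_all add: algebra_simps power2_eq_square)
  have q0: "196 * lam\<^sup>2 = 2 * (4 * v2-2 * v3)\<^sup>2"
    using ev[of 0 1] by (simp add: algebra_simps power2_eq_square)
  have 13: "v1 * v3 = 0" using p0 by algebra
  have "v3 = 0"
  proof (rule ccontr)
    assume "v3 \<noteq> 0"
    then have "v1 = 0" using 13 by simp
    then have "196 * lam\<^sup>2 = 8 * v3\<^sup>2" using p0(1) by (simp add: power2_eq_square)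
    then have "v3\<^sup>2 = 0" using 00 by linarith
    then show False using \<open>v3 \<noteq> 0\<close> by simp
  qed
  then show ?thesis using 00 p0 q0 by simp
qed

text \<open>Near a point where $f'' \<noteq> 0$ the function $f'$ is injective by the mean value theorem. The slope
  $0$ is left out because the mixed derivative carries the factor $pq$.\<close>

lemma infinite_slopes:
  assumes "open I" "smooth_fun_on f I" "x0 \<in> I" "deriv (deriv f) x0 \<noteq> 0"
  shows "infinite (deriv f ` {x \<in> I. deriv (deriv f) x \<noteq> 0} - {0})"
proof -
  have d: "(deriv f has_real_derivative deriv (deriv f) x) (at x)" if "x \<in> I" for x
    by (rule smooth_fun_on_has_derivative[OF smooth_fun_on_deriv[OF assms(2)] assms(1) that])
  have d2: "isCont (deriv (deriv f)) x" if "x \<in> I" for x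
    using smooth_fun_on_has_derivative[OF smooth_fun_on_deriv[OF smooth_fun_on_deriv[OF assms(2)]] assms(1) that]
    by (rule DERIV_isCont)
  have "\<forall>\<^sub>F x in nhds x0. deriv (deriv f) x \<noteq> 0"
    using tendsto_imp_eventually_ne[OF d2[OF assms(3), unfolded isCont_def] assms(4)] assms(4)
    by (simp add: eventually_nhds_conv_at)
  then have "\<forall>\<^sub>F x in nhds x0. x \<in> I \<and> deriv (deriv f) x \<noteq> 0"
    using eventually_nhds_in_open[OF assms(1,3)] by (rule eventually_conj[rotated])
  then obtain e where e: "e > 0" "\<And>x. dist x x0 < e \<Longrightarrow> x \<in> I \<and> deriv (deriv f) x \<noteq> 0"
    unfolding eventually_nhds_metric by blast
  let ?S = "{x0<..<x0 + e}"
  have S: "x \<in> I" "deriv (deriv f) x \<noteq> 0" if "x \<in> ?S" for x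
    using that e(2)[of x] by (auto simp: dist_real_def)
  have inj: "deriv f a \<noteq> deriv f b" if "a \<in> ?S" "b \<in> ?S" "a < b" for a b
  proof
    assume eq: "deriv f a = deriv f b"
    have in_S: "x \<in> ?S" if "a \<le> x" "x \<le> b" for x
      using that \<open>a \<in> ?S\<close> \<open>b \<in> ?S\<close> by auto
    obtain z where z: "a < z" "z < b" "deriv f b - deriv f a = (b - a) * deriv (deriv f) z"
      using MVT2[OF \<open>a < b\<close> d[OF S(1)[OF in_S]]] by blast
    then have "deriv (deriv f) z = 0" using eq \<open>a < b\<close> by simp
    then show False using S(2)[OF in_S] z by auto
  qed
  then have "inj_on (deriv f) ?S"
    by (intro linorder_inj_onI') blast
  then have "infinite (deriv f ` ?S)"
    using e(1) by (simp add: finite_image_iff)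
  moreover have "deriv f ` ?S \<subseteq> deriv f ` {x \<in> I. deriv (deriv f) x \<noteq> 0}"
    using S by blast
  ultimately show ?thesis
    by (meson Diff_infinite_finite finite.emptyI finite.insertI infinite_super)
qed

text \<open>The heart of the classification. If $f''$ and $g''$ were nonzero somewhere, the slopes
  would satisfy a polynomial identity on a product of infinite sets, which forces the density vector
  to vanish.\<close>

lemma second_derivative_vanishes:
  assumes IJ: "open I" "open J" and fg: "smooth_fun_on f I" "smooth_fun_on g J"
    and v: "(v1, v2, v3) \<noteq> (0, 0, 0)"
    and eq: "\<And>x y p q. x \<in> I \<Longrightarrow> y \<in> J \<Longrightarrow> p = deriv f x \<Longrightarrow> q = deriv g y \<Longrightarrow>
       (1 + q\<^sup>2) * deriv (deriv f) x + (1 + p\<^sup>2) * deriv (deriv g) y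
       = 2 * lam * sqrt (1 + p\<^sup>2 + q\<^sup>2) ^ 3 + (1 + p\<^sup>2 + q\<^sup>2) * (v3 - v1 * p - v2 * q)"
  shows "(\<forall>x\<in>I. deriv (deriv f) x = 0) \<or> (\<forall>y\<in>J. deriv (deriv g) y = 0)"
proof (rule ccontr)
  assume "\<not> ?thesis"
  then obtain x0 y0 where xy0: "x0 \<in> I" "deriv (deriv f) x0 \<noteq> 0" "y0 \<in> J" "deriv (deriv g) y0 \<noteq> 0" by blast
  let ?A = "deriv f ` {x \<in> I. deriv (deriv f) x \<noteq> 0} - {0}"
  let ?B = "deriv g ` {y \<in> J. deriv (deriv g) y \<noteq> 0} - {0}"
  have sep: "soliton_quotient lam v1 v2 v3 (deriv f x) (deriv g y) =
     deriv (deriv f) x / (1 + (deriv f x)\<^sup>2) + deriv (deriv g) y / (1 + (deriv g y)\<^sup>2)"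
    if "x \<in> I" "y \<in> J" for x y
  proof -
    have nz: "1+(deriv f x)\<^sup>2 \<noteq> 0" "1+(deriv g y)\<^sup>2 \<noteq> 0" by (smt (verit) zero_le_power2)+
    show ?thesis unfolding soliton_quotient_def eq[OF that refl refl, symmetric] using nz
      by (simp add: add_frac_eq mult.commute)
  qed
  have dpdq0: "soliton_quotient_dpdq lam v1 v2 v3 (deriv f x) (deriv g y) = 0"
    if "x \<in> I" "y \<in> J" "deriv (deriv f) x \<noteq> 0" "deriv (deriv g) y \<noteq> 0" for x y
    by (rule separated_imp_mixed_derivative_zero[where P = "deriv f" and Q = "deriv g"
          and P' = "deriv (deriv f)" and Q' = "deriv (deriv g)",
          OF IJ soliton_quotient_has_derivative soliton_quotient_dp_has_derivative])
      (use IJ fg sep that in \<open>auto intro: smooth_fun_on_has_derivative smooth_fun_on_deriv\<close>)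
  have "lam\<^sup>2 * (mixed_poly p q)\<^sup>2 =
      (1+p\<^sup>2+q\<^sup>2) * (v1 * (p * (p\<^sup>2+3)) + v2 * (q * (q\<^sup>2+3)) - 2 * v3)\<^sup>2"
    if "p \<in> ?A" "q \<in> ?B" for p q
  proof -
    have dpdq: "soliton_quotient_dpdq lam v1 v2 v3 p q = 0" using that dpdq0 by auto
    have nz: "1+p\<^sup>2 \<noteq> 0" "1+q\<^sup>2 \<noteq> 0" by (smt (verit) zero_le_power2)+
    have s: "1+p\<^sup>2+q\<^sup>2 > 0" by (simp add: add_pos_nonneg)
    have "v1 * (p * (p\<^sup>2+3)) + v2 * (q * (q\<^sup>2+3)) - 2 * v3 = lam * mixed_poly p q / sqrt (1+p\<^sup>2+q\<^sup>2)"
      using dpdq nz that unfolding soliton_quotient_dpdq_def by auto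
    then show ?thesis using s by (simp add: power_mult_distrib power_divide)
  qed
  then have "lam\<^sup>2 * (mixed_poly p q)\<^sup>2 =
      (1+p\<^sup>2+q\<^sup>2) * (v1 * (p * (p\<^sup>2+3)) + v2 * (q * (q\<^sup>2+3)) - 2 * v3)\<^sup>2" for p q
    using squared_identity_extend[OF infinite_slopes[OF IJ(1) fg(1) xy0(1,2)] infinite_slopes[OF IJ(2) fg(2) xy0(3,4)]]
    by blast
  then show False using squared_identity_imp_zero v by blast
qed

section \<open>Affine summands and rulings\<close>

text \<open>The rulings are the pieces with a fixed parameter $u$; the injectivity hypothesis says that
  different values of $u$ lie on different lines in direction $w$.\<close>

lemma cylindricalI:
  fixes c :: "real \<Rightarrow> real^3"
  assumes "w \<noteq> 0" "open T" "is_interval T" "T \<noteq> {}"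
    and S: "S = (\<lambda>(t, u). c u + t *\<^sub>R w) ` (T \<times> U)"
    and inj: "\<And>t t' u u'. c u + t *\<^sub>R w = c u' + t' *\<^sub>R w \<Longrightarrow> u = u'"
  shows "cylindrical w S"
  unfolding cylindrical_def
proof (intro conjI exI[of _ "(\<lambda>u. (\<lambda>t. c u + t *\<^sub>R w) ` T) ` U"] ballI)
  show "pairwise disjnt ((\<lambda>u. (\<lambda>t. c u + t *\<^sub>R w) ` T) ` U)"
    unfolding pairwise_def disjnt_def using inj by fast
  show "\<Union> ((\<lambda>u. (\<lambda>t. c u + t *\<^sub>R w) ` T) ` U) = S"
    unfolding S by auto
  show "ruling w L" if "L \<in> (\<lambda>u. (\<lambda>t. c u + t *\<^sub>R w) ` T) ` U" for L
    using that assms(2-4) unfolding ruling_def by blast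
qed fact

lemma translation_invariantI:
  fixes c :: "real \<Rightarrow> real^3"
  assumes S: "S = (\<lambda>(t, u). c u + t *\<^sub>R w) ` (UNIV \<times> U)"
  shows "translation_invariant w S"
  unfolding translation_invariant_def
proof (intro allI equalityI subsetI)
  fix r p assume "p \<in> (\<lambda>p. p + r *\<^sub>R w) ` S"
  then obtain t u where "u \<in> U" "p = c u + t *\<^sub>R w + r *\<^sub>R w" unfolding S by auto
  then have "p = (\<lambda>(t, u). c u + t *\<^sub>R w) (t + r, u)" "(t + r, u) \<in> UNIV \<times> U"
    by (auto simp: scaleR_add_left add.assoc)
  then show "p \<in> S" unfolding S by blast
next
  fix r p assume "p \<in> S"
  then obtain t u where tu: "u \<in> U" "p = c u + t *\<^sub>R w" unfolding S by auto
  then have "c u + (t - r) *\<^sub>R w \<in> S" unfolding S by auto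
  moreover have "p = c u + (t - r) *\<^sub>R w + r *\<^sub>R w"
    using tu(2) by (simp add: scaleR_diff_left)
  ultimately show "p \<in> (\<lambda>p. p + r *\<^sub>R w) ` S" by blast
qed

lemma graph_set_affine1:
  assumes "\<forall>x\<in>I. f x = a * x + b"
  shows "graph_set f g I J =
    (\<lambda>(x, y). vector [0, y, b + g y] + x *\<^sub>R vector [1, 0, a]) ` (I \<times> J)"
  unfolding graph_set_def
  by (rule image_cong) (use assms in \<open>auto simp: sum_graph_def vec_eq_iff forall_3\<close>)

lemma graph_set_affine2:
  assumes "\<forall>y\<in>J. g y = a * y + b"
  shows "graph_set f g I J =
    (\<lambda>(y, x). vector [x, 0, b + f x] + y *\<^sub>R vector [0, 1, a]) ` (J \<times> I)"
proof -
  have "graph_set f g I J = (\<lambda>(y, x). sum_graph f g x y) ` (J \<times> I)"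
    unfolding graph_set_def by (force simp: image_iff)
  also have "\<dots> = (\<lambda>(y, x). vector [x, 0, b + f x] + y *\<^sub>R vector [0, 1, a]) ` (J \<times> I)"
    by (rule image_cong) (use assms in \<open>auto simp: sum_graph_def vec_eq_iff forall_3\<close>)
  finally show ?thesis .
qed

lemma second_deriv_zero_imp_affine:
  assumes "open I" "is_interval I" "smooth_fun_on f I" "\<forall>x\<in>I. deriv (deriv f) x = 0"
  shows "\<exists>a b. (\<forall>x\<in>I. f x = a * x + b)"
proof -
  have I: "convex I" using assms(2) by (simp add: is_interval_convex)
  have "\<exists>a. \<forall>x\<in>I. deriv f x = a"
    using smooth_fun_on_has_derivative[OF smooth_fun_on_deriv[OF assms(3)] assms(1)] assms(4)
    by (intro has_field_derivative_zero_constant[OF I]) (auto intro: has_field_derivative_at_within)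
  then obtain a where a: "\<And>x. x \<in> I \<Longrightarrow> deriv f x = a" by blast
  have "\<exists>b. \<forall>x\<in>I. f x - a * x = b"
  proof (rule has_field_derivative_zero_constant[OF I])
    fix x assume "x \<in> I"
    then have "(f has_real_derivative a) (at x)"
      using smooth_fun_on_has_derivative[OF assms(3,1)] a by metis
    then have "((\<lambda>x. f x - a * x) has_real_derivative 0) (at x)"
      by (auto intro!: derivative_eq_intros)
    then show "((\<lambda>x. f x - a * x) has_real_derivative 0) (at x within I)"
      by (rule has_field_derivative_at_within)
  qed
  then obtain b where "\<And>x. x \<in> I \<Longrightarrow> f x - a * x = b" by blast
  then have "\<forall>x\<in>I. f x = a * x + b" by (auto simp: algebra_simps)
  then show ?thesis by blast
qed

lemma deriv_affine_on:
  assumes "open I" "\<forall>x\<in>I. f x = a * x + b" "x \<in> I"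
  shows "deriv f x = a" "deriv (deriv f) x = 0"
proof -
  have 1: "deriv f x = a" if "x \<in> I" for x
    by (rule DERIV_imp_deriv, rule has_field_derivative_transform_within_open[OF _ assms(1) that, where f = "\<lambda>x. a * x + b"])
      (use assms(2) in \<open>auto intro!: derivative_eq_intros\<close>)
  then show "deriv f x = a" using assms(3) .
  show "deriv (deriv f) x = 0"
    by (rule DERIV_imp_deriv, rule has_field_derivative_transform_within_open[OF _ assms(1,3), where f = "\<lambda>x. a"])
      (use 1 in auto)
qed

lemma powr_three_halves: "s \<ge> 0 \<Longrightarrow> s powr (3/2) = sqrt s ^ 3"
  by (simp add: powr_half_sqrt[symmetric] powr_powr flip: powr_realpow')

section \<open>Classification\<close>

theorem theorem3p1:
  fixes lam :: real and v :: "real^3" and f g :: "real \<Rightarrow> real" and I J :: "real set"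
  assumes "norm v = 1"
    and "open I" "is_interval I" "I \<noteq> {}" "smooth_fun_on f I"
    and "open J" "is_interval J" "J \<noteq> {}" "smooth_fun_on g J"
  shows
    "(translating_soliton lam v (sum_graph f g) (I \<times> J) \<longrightarrow>
        ((\<exists>a b c d. (\<forall>x\<in>I. f x = a * x + b) \<and> (\<forall>y\<in>J. g y = c * y + d))
           \<and> planar (graph_set f g I J))
      \<or> (\<exists>a b. (\<forall>x\<in>I. f x = a * x + b) \<and> profile_ode lam (v$1) (v$2) (v$3) a g J)
      \<or> (\<exists>a b. (\<forall>y\<in>J. g y = a * y + b) \<and> profile_ode lam (v$2) (v$1) (v$3) a f I))
   \<and> (\<forall>a b. (\<forall>x\<in>I. f x = a * x + b) \<and> profile_ode lam (v$1) (v$2) (v$3) a g J \<longrightarrow>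
        translating_soliton lam v (sum_graph f g) (I \<times> J)
        \<and> cylindrical (vector [1, 0, a]) (graph_set f g I J)
        \<and> (I = UNIV \<longrightarrow> translation_invariant (vector [1, 0, a]) (graph_set f g I J)))
   \<and> (\<forall>a b. (\<forall>y\<in>J. g y = a * y + b) \<and> profile_ode lam (v$2) (v$1) (v$3) a f I \<longrightarrow>
        translating_soliton lam v (sum_graph f g) (I \<times> J)
        \<and> cylindrical (vector [0, 1, a]) (graph_set f g I J)
        \<and> (J = UNIV \<longrightarrow> translation_invariant (vector [0, 1, a]) (graph_set f g I J)))"
proof (intro conjI allI impI)
  note sm = \<open>open I\<close> \<open>open J\<close> \<open>smooth_fun_on f I\<close> \<open>smooth_fun_on g J\<close>
  note soliton_iff = translating_soliton_sum_graph_iff[OF sm, of lam v, unfolded Let_def]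
  have powr: "(1 + a\<^sup>2 + q\<^sup>2) powr (3/2) = sqrt (1 + a\<^sup>2 + q\<^sup>2) ^ 3" for a q :: real
    by (rule powr_three_halves) simp
  \<comment> \<open>For affine $f$ the first summand of the soliton equation is zero and what remains is the profile
    equation; as $I$ is nonempty, it holds at every point of $J$.\<close>
  have f_affine: "translating_soliton lam v (sum_graph f g) (I \<times> J) \<longleftrightarrow>
      profile_ode lam (v$1) (v$2) (v$3) a g J" if "\<forall>x\<in>I. f x = a * x + b" for a b
    using deriv_affine_on[OF \<open>open I\<close> that] \<open>I \<noteq> {}\<close>
    unfolding soliton_iff profile_ode_def powr by (auto simp: algebra_simps)
  have g_affine: "translating_soliton lam v (sum_graph f g) (I \<times> J) \<longleftrightarrow>
      profile_ode lam (v$2) (v$1) (v$3) a f I" if "\<forall>y\<in>J. g y = a * y + b" for a b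
    using deriv_affine_on[OF \<open>open J\<close> that] \<open>J \<noteq> {}\<close>
    unfolding soliton_iff profile_ode_def powr by (auto simp: algebra_simps)
  {
    assume sol: "translating_soliton lam v (sum_graph f g) (I \<times> J)"
    have "v \<noteq> 0" using \<open>norm v = 1\<close> by auto
    then have v: "(v$1, v$2, v$3) \<noteq> (0, 0, 0)" by (auto simp: vec_eq_iff forall_3)
    have "(\<forall>x\<in>I. deriv (deriv f) x = 0) \<or> (\<forall>y\<in>J. deriv (deriv g) y = 0)"
      by (rule second_derivative_vanishes[OF sm v]) (use sol soliton_iff in blast)
    then show "((\<exists>a b c d. (\<forall>x\<in>I. f x = a * x + b) \<and> (\<forall>y\<in>J. g y = c * y + d))
           \<and> planar (graph_set f g I J))
      \<or> (\<exists>a b. (\<forall>x\<in>I. f x = a * x + b) \<and> profile_ode lam (v$1) (v$2) (v$3) a g J)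
      \<or> (\<exists>a b. (\<forall>y\<in>J. g y = a * y + b) \<and> profile_ode lam (v$2) (v$1) (v$3) a f I)"
      using second_deriv_zero_imp_affine[OF \<open>open I\<close> \<open>is_interval I\<close> \<open>smooth_fun_on f I\<close>]
        second_deriv_zero_imp_affine[OF \<open>open J\<close> \<open>is_interval J\<close> \<open>smooth_fun_on g J\<close>]
        sol f_affine g_affine by meson
  next
    fix a b assume *: "(\<forall>x\<in>I. f x = a * x + b) \<and> profile_ode lam (v$1) (v$2) (v$3) a g J"
    then show "translating_soliton lam v (sum_graph f g) (I \<times> J)" using f_affine by blast
    note S = graph_set_affine1[OF conjunct1[OF *], of g J]
    show "cylindrical (vector [1, 0, a]) (graph_set f g I J)"
      by (rule cylindricalI[OF _ \<open>open I\<close> \<open>is_interval I\<close> \<open>I \<noteq> {}\<close> S])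
        (auto simp: vec_eq_iff forall_3)
    show "translation_invariant (vector [1, 0, a]) (graph_set f g I J)" if "I = UNIV"
      unfolding that by (rule translation_invariantI[OF S[unfolded that]])
  next
    fix a b assume *: "(\<forall>y\<in>J. g y = a * y + b) \<and> profile_ode lam (v$2) (v$1) (v$3) a f I"
    then show "translating_soliton lam v (sum_graph f g) (I \<times> J)" using g_affine by blast
    note S = graph_set_affine2[OF conjunct1[OF *], of f I]
    show "cylindrical (vector [0, 1, a]) (graph_set f g I J)"
      by (rule cylindricalI[OF _ \<open>open J\<close> \<open>is_interval J\<close> \<open>J \<noteq> {}\<close> S])
        (auto simp: vec_eq_iff forall_3)
    show "translation_invariant (vector [0, 1, a]) (graph_set f g I J)" if "J = UNIV"
      unfolding that by (rule translation_invariantI[OF S[unfolded that]])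
  }
qed

end
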